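(* Let $t\ge 2$ and $\ell\ge 1$ be integers. There exists an $\ell t \times t$ Vatican design in each of the following cases: (i) $t+1$ is prime (and $\ell\ge 1$ arbitrary); (ii) $5 \le t \le 14$ and $\ell > 1$; (iii) $t \in \{3, 15\}$ and $\ell$ is even; (iv) $t$ is prime and $\ell$ is a multiple of $t-1$.
   Context: A crossover design with $n$ subjects, $t$ treatments and $p$ periods is an $n \times p$ array $D$ whose entries are treatments, $D_{ij}$ being the treatment received by subject $i$ in period $j$. Here we only consider designs with $p = t$ that are uniform: each treatment occurs exactly once in each row, and each treatment occurs the same number of times (namely $n/t$) in each column. For an ordered pair $(x,y)$ of distinct treatments and $1 \le d \le t-1$, let $o_d(x,y)$ be the number of times, counted over all rows, that treatment $y$ occurs exactly $d$ periods after treatment $x$ in the same row. Such a design is Roman-$k$ if $o_d(x,y) \le n/t$ for all ordered pairs of distinct treatments $(x,y)$ and all $d$ with $1 \le d \le k$. It is Vatican if it is Roman-$(t-1)$. An "$\ell t \times t$ design" is such a design with $n = \ell t$ subjects and $t$ treatments and periods. *)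

theory Defs
  imports Complex_Main "HOL-Computational_Algebra.Primes"
begin

text \<open>
  An array is a function \<open>D\<close> with \<open>D i j\<close> the treatment of subject \<open>i\<close> in period \<open>j\<close>. Subjects,
  periods and treatments are \<open>{..<n}\<close>, \<open>{..<p}\<close> and \<open>{..<t}\<close>; values of \<open>D\<close> outside
  \<open>{..<n} \<times> {..<p}\<close> are irrelevant.
\<close>

definition crossover_design :: "nat \<Rightarrow> nat \<Rightarrow> nat \<Rightarrow> (nat \<Rightarrow> nat \<Rightarrow> nat) \<Rightarrow> bool" where
  "crossover_design n t p D \<longleftrightarrow> (\<forall>i<n. \<forall>j<p. D i j < t)"

definition uniform_design :: "nat \<Rightarrow> nat \<Rightarrow> (nat \<Rightarrow> nat \<Rightarrow> nat) \<Rightarrow> bool" where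
  "uniform_design n t D \<longleftrightarrow>
     crossover_design n t t D \<and>
     (\<forall>i<n. \<forall>x<t. card {j. j < t \<and> D i j = x} = 1) \<and>
     (\<forall>j<t. \<forall>x<t. real (card {i. i < n \<and> D i j = x}) = real n / real t)"

definition occ :: "nat \<Rightarrow> nat \<Rightarrow> (nat \<Rightarrow> nat \<Rightarrow> nat) \<Rightarrow> nat \<Rightarrow> nat \<Rightarrow> nat \<Rightarrow> nat" where
  "occ n t D d x y = card {(i, j). i < n \<and> j + d < t \<and> D i j = x \<and> D i (j + d) = y}"

definition roman_design :: "nat \<Rightarrow> nat \<Rightarrow> nat \<Rightarrow> (nat \<Rightarrow> nat \<Rightarrow> nat) \<Rightarrow> bool" where
  "roman_design k n t D \<longleftrightarrow>
     uniform_design n t D \<and>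
     (\<forall>d. 1 \<le> d \<and> d \<le> k \<longrightarrow>
        (\<forall>x<t. \<forall>y<t. x \<noteq> y \<longrightarrow> real (occ n t D d x y) \<le> real n / real t))"

definition vatican_design :: "nat \<Rightarrow> nat \<Rightarrow> (nat \<Rightarrow> nat \<Rightarrow> nat) \<Rightarrow> bool" where
  "vatican_design n t D \<longleftrightarrow> roman_design (t - 1) n t D"

end

(*
  If every row of a design is replaced by its t translates modulo t, the column condition becomes
  automatic, and o_d(x,y) counts how often y - x occurs as a difference at distance d in the
  original ("base") rows. So an lt x t Vatican design is obtained from l permutations of Z_t in
  which every nonzero z occurs at most l times among the differences at distance d, for each d.
  For t prime the rows j |-> aj with a = 1, ..., t - 1 have this property. For t + 1 prime the
  multiplication table of the units modulo t + 1 is a Vatican square. Stacking designs adds their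
  values of l, so in the remaining cases base rows for l = 2 and l = 3 suffice.
*)

theory Submission
  imports Defs "HOL-Number_Theory.Cong"
begin

section \<open>Criteria for designs in terms of natural numbers\<close>

lemma card_row_eq_1:
  fixes f :: "nat \<Rightarrow> nat"
  assumes "inj_on f {..<t}" "\<And>j. j < t \<Longrightarrow> f j < t" "x < t"
  shows "card {j. j < t \<and> f j = x} = 1"
proof -
  have "f ` {..<t} = {..<t}"
    using assms by (intro endo_inj_surj) auto
  then obtain j where j: "j < t" "f j = x"
    using assms(3) by (metis imageE lessThan_iff)
  then have "{j. j < t \<and> f j = x} = {j}"
    using assms(1) by (auto simp: inj_on_def)
  then show ?thesis
    by simp
qed

text \<open>With \<open>n = l * t\<close> the real quotient \<open>n / t\<close> becomes
  \<open>l\<close>, so the constructions only count naturals. For rows injectivity suffices, since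
  an injective self-map of a finite set is onto.\<close>

lemma uniform_designI:
  assumes "t > 0"
    and "\<And>i j. i < l * t \<Longrightarrow> j < t \<Longrightarrow> D i j < t"
    and "\<And>i. i < l * t \<Longrightarrow> inj_on (D i) {..<t}"
    and "\<And>j x. j < t \<Longrightarrow> x < t \<Longrightarrow> card {i. i < l * t \<and> D i j = x} = l"
  shows "uniform_design (l * t) t D"
  using assms unfolding uniform_design_def crossover_design_def
  by (auto intro!: card_row_eq_1[unfolded One_nat_def])

lemma vatican_designI:
  assumes "t > 0"
    and "uniform_design (l * t) t D"
    and "\<And>d x y. 0 < d \<Longrightarrow> d < t \<Longrightarrow> x < t \<Longrightarrow> y < t \<Longrightarrow> x \<noteq> y \<Longrightarrow> occ (l * t) t D d x y \<le> l"
  shows "vatican_design (l * t) t D"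
  using assms unfolding vatican_design_def roman_design_def by auto

subsection \<open>Stacking designs\<close>

definition stack :: "nat \<Rightarrow> (nat \<Rightarrow> nat \<Rightarrow> nat) \<Rightarrow> (nat \<Rightarrow> nat \<Rightarrow> nat) \<Rightarrow> nat \<Rightarrow> nat \<Rightarrow> nat" where
  "stack m D E i = (if i < m then D i else E (i - m))"

lemma stack_cases:
  assumes "i < m + n"
  obtains "i < m" "stack m D E i = D i" | "i - m < n" "stack m D E i = E (i - m)"
  using assms by (cases "i < m") (auto simp: stack_def)

lemma card_stack_column:
  "card {i. i < m + n \<and> stack m D E i j = x}
     = card {i. i < m \<and> D i j = x} + card {i. i < n \<and> E i j = x}"
proof -
  have *: "{i. i < m + n \<and> stack m D E i j = x}
      = {i. i < m \<and> D i j = x} \<union> (+) m ` {i. i < n \<and> E i j = x}"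
    by (auto simp: stack_def image_iff split: if_splits)
      (metis add_diff_inverse_nat add.commute less_diff_conv2 not_less)+
  show ?thesis
    unfolding * by (subst card_Un_disjoint) (auto simp: card_image)
qed

lemma finite_occ_set:
  fixes D :: "nat \<Rightarrow> nat \<Rightarrow> nat"
  shows "finite {(i, j). i < n \<and> j + d < t \<and> D i j = x \<and> D i (j + d) = y}"
  by (rule finite_subset[of _ "{..<n} \<times> {..<t}"]) auto

text \<open>An occurrence lies within one row, hence in one of the two blocks; the shift by
  \<open>m\<close> carries those of \<open>E\<close> into place.\<close>

lemma occ_stack_le: "occ (m + n) t (stack m D E) d x y \<le> occ m t D d x y + occ n t E d x y"
proof -
  let ?A = "{(i, j). i < m \<and> j + d < t \<and> D i j = x \<and> D i (j + d) = y}"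
  let ?B = "{(i, j). i < n \<and> j + d < t \<and> E i j = x \<and> E i (j + d) = y}"
  let ?S = "{(i, j). i < m + n \<and> j + d < t \<and> stack m D E i j = x \<and> stack m D E i (j + d) = y}"
  have "?S \<subseteq> ?A \<union> map_prod ((+) m) id ` ?B"
  proof
    fix s assume "s \<in> ?S"
    then obtain i j where s: "s = (i, j)" "i < m + n" "j + d < t"
      "stack m D E i j = x" "stack m D E i (j + d) = y"
      by blast
    show "s \<in> ?A \<union> map_prod ((+) m) id ` ?B"
    proof (cases "i < m")
      case False
      then have "s = map_prod ((+) m) id (i - m, j)" "(i - m, j) \<in> ?B"
        using s by (auto simp: stack_def)
      then show ?thesis
        by blast
    qed (use s in \<open>auto simp: stack_def\<close>)
  qed
  then have "card ?S \<le> card (?A \<union> map_prod ((+) m) id ` ?B)"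
    by (intro card_mono finite_UnI finite_imageI finite_occ_set)
  also have "\<dots> \<le> card ?A + card ?B"
    by (rule order_trans[OF card_Un_le add_left_mono[OF card_image_le[OF finite_occ_set]]])
  finally show ?thesis
    unfolding occ_def .
qed

text \<open>Column counts add exactly and occurrences at most add up, which fits m/t + n/t = (m +
  n)/t.\<close>

lemma vatican_stack:
  assumes "vatican_design m t D" "vatican_design n t E"
  shows "vatican_design (m + n) t (stack m D E)"
proof -
  have "real (occ (m + n) t (stack m D E) d x y) \<le> real (m + n) / real t"
    if "1 \<le> d" "d \<le> t - 1" "x < t" "y < t" "x \<noteq> y" for d x y
  proof -
    have "real (occ m t D d x y) \<le> real m / real t" "real (occ n t E d x y) \<le> real n / real t"
      using assms that unfolding vatican_design_def roman_design_def by blast+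
    moreover have "real (occ (m + n) t (stack m D E) d x y)
        \<le> real (occ m t D d x y) + real (occ n t E d x y)"
      using occ_stack_le[of m n t D E d x y] by linarith
    ultimately show ?thesis
      by (simp add: add_divide_distrib)
  qed
  moreover have "uniform_design (m + n) t (stack m D E)"
    using assms unfolding vatican_design_def roman_design_def uniform_design_def crossover_design_def
    by (auto simp: card_stack_column add_divide_distrib elim!: stack_cases[of _ m n D E])
  ultimately show ?thesis
    unfolding vatican_design_def roman_design_def by blast
qed

lemma vatican_multiple:
  assumes "vatican_design (l * t) t D"
  shows "\<exists>E. vatican_design (k * l * t) t E"
proof (induction k)
  case 0
  \<comment> \<open>Without rows every count is 0, as is the bound 0/t.\<close>
  have "vatican_design 0 t D" for D
    by (simp add: vatican_design_def roman_design_def uniform_design_def crossover_design_def occ_def)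
  then show ?case by auto
next
  case (Suc k)
  then obtain E where "vatican_design (k * l * t) t E" by blast
  from vatican_stack[OF assms this] show ?case
    by (auto simp: algebra_simps)
qed

lemma vatican_2_3:
  assumes "vatican_design (2 * t) t D" "vatican_design (3 * t) t E" "l > 1"
  shows "\<exists>F. vatican_design (l * t) t F"
proof (cases "even l")
  case True
  then show ?thesis
    using vatican_multiple[OF assms(1), of "l div 2"] by simp
next
  case False
  \<comment> \<open>An odd \<open>l > 1\<close> is at least 3, so \<open>l - 3\<close> is a true,
    even difference: copies of \<open>D\<close> fill it and a single \<open>E\<close> supplies the
    rest.\<close>
  then have "l = (l - 3) div 2 * 2 + 3"
    using assms(3) by presburger
  moreover obtain F where "vatican_design ((l - 3) div 2 * 2 * t) t F"
    using vatican_multiple[OF assms(1)] by blast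
  note vatican_stack[OF this assms(2)]
  ultimately show ?thesis
    by (metis add_mult_distrib)
qed

subsection \<open>Multiplication tables modulo a prime\<close>

lemma coprime_less_prime:
  fixes k p :: nat
  assumes "prime p" "0 < k" "k < p"
  shows "coprime k p"
  using assms by (metis coprime_commute prime_imp_coprime nat_dvd_not_less)

text \<open>Treatment x stands for the unit x + 1 modulo p = t + 1. Row i is an arithmetic
  progression, so units d periods apart differ by (i + 1) d. As d is a unit, a pair (x, y)
  determines i, and then x determines j: each pair occurs at most once.\<close>

lemma vatican_mult_table:
  assumes "prime (t + 1)"
  shows "vatican_design t t (\<lambda>i j. (i + 1) * (j + 1) mod (t + 1) - 1)"
proof -
  define p where "p = t + 1"
  have p: "prime p" and t: "t > 0"
    using assms prime_gt_1_nat[OF assms] by (auto simp: p_def)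
  define D where "D = (\<lambda>i j. (i + 1) * (j + 1) mod p - 1)"
  have cop: "coprime (k + 1) p" if "k < t" for k
    using that p by (intro coprime_less_prime) (auto simp: p_def)
  \<comment> \<open>The residue is never 0, so the subtraction of 1 in \<open>D\<close> does not
    truncate.\<close>
  have mod: "(i + 1) * (j + 1) mod p = D i j + 1" if "i < t" "j < t" for i j
  proof -
    have "coprime ((i + 1) * (j + 1)) p"
      using cop that by (simp del: One_nat_def)
    then have "(i + 1) * (j + 1) mod p \<noteq> 0"
      using p by (metis coprime_absorb_left dvd_eq_mod_eq_0 coprime_commute not_prime_unit)
    then show ?thesis
      by (simp add: D_def)
  qed
  have D_less: "D i j < t" if "i < t" "j < t" for i j
    using mod[OF that] mod_less_divisor[of p "(i + 1) * (j + 1)"] by (simp add: p_def)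
  have sym: "D i j = D j i" for i j
    unfolding D_def by (subst mult.commute) (rule refl)
  have cong: "[(i + 1) * (j + 1) = (i' + 1) * (j' + 1)] (mod p)"
    if "i < t" "j < t" "i' < t" "j' < t" "D i j = D i' j'" for i j i' j'
    unfolding cong_def using that by (simp only: mod)
  have inj: "j = j'" if "i < t" "j < t" "j' < t" "D i j = D i j'" for i j j'
  proof -
    have "[(i + 1) * (j + 1) = (i + 1) * (j' + 1)] (mod p)"
      using that by (intro cong)
    then have "[j + 1 = j' + 1] (mod p)"
      using cong_mult_lcancel_nat[OF cop[OF that(1)]] by blast
    then show ?thesis
      using that by (simp add: cong_def p_def)
  qed
  have occ: "occ t t D d x y \<le> 1" if "0 < d" "d < t" for d x y
  proof -
    have unique: "i = i' \<and> j = j'" if "i < t" "i' < t" "j + d < t" "j' + d < t"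
      "D i j = D i' j'" "D i (j + d) = D i' (j' + d)" for i i' j j'
    proof -
      have "[(i + 1) * (j + 1) = (i' + 1) * (j' + 1)] (mod p)"
        using that by (intro cong) auto
      \<comment> \<open>Subtracting the congruence for x from that for y would give the claim;
        adding \<open>(i' + 1) * d\<close> to both sides does this within the naturals.\<close>
      then have "[(i + 1) * (j + 1) + (i' + 1) * d = (i' + 1) * (j' + 1) + (i' + 1) * d] (mod p)"
        by (rule cong_add) simp
      also have "(i' + 1) * (j' + 1) + (i' + 1) * d = (i' + 1) * (j' + d + 1)"
        by (simp add: algebra_simps)
      also have "[(i' + 1) * (j' + d + 1) = (i + 1) * (j + d + 1)] (mod p)"
        using that by (intro cong) auto
      also have "(i + 1) * (j + d + 1) = (i + 1) * (j + 1) + (i + 1) * d"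
        by (simp add: algebra_simps)
      finally have "[(i + 1) * d = (i' + 1) * d] (mod p)"
        using cong_add_lcancel_nat cong_sym by blast
      moreover have "coprime d p"
        using cop[of "d - 1"] \<open>0 < d\<close> \<open>d < t\<close> by simp
      ultimately have "[i + 1 = i' + 1] (mod p)"
        using cong_mult_rcancel_nat by blast
      then have "i = i'"
        using that by (simp add: cong_def p_def)
      moreover have "j = j'"
        by (rule inj[of i]) (use that calculation in simp_all)
      ultimately show ?thesis ..
    qed
    show ?thesis
      unfolding occ_def One_nat_def card_le_Suc0_iff_eq[OF finite_occ_set]
      by (clarsimp, rule unique) simp_all
  qed
  have rows: "inj_on (D i) {..<t}" if "i < t" for i
    using inj[OF that] by (auto intro!: inj_onI)
  \<comment> \<open>The table is symmetric, so its columns are its rows.\<close>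
  have columns: "card {i. i < t \<and> D i j = x} = 1" if "j < t" "x < t" for j x
    using card_row_eq_1[OF rows[OF that(1)] D_less[OF that(1)] that(2)] by (simp only: sym)
  have "uniform_design (1 * t) t D"
    using D_less rows columns t by (intro uniform_designI) auto
  then have "vatican_design (1 * t) t D"
    using occ t by (intro vatican_designI) auto
  then show ?thesis
    by (simp add: D_def p_def)
qed

subsection \<open>Developing base rows cyclically\<close>

lemma cong_add_lcancel_less:
  fixes a b c t :: nat
  assumes "(a + b) mod t = (a + c) mod t" "b < t" "c < t"
  shows "b = c"
  using assms cong_add_lcancel_nat[of a b c t] by (simp add: cong_def)

text \<open>Subject i receives base row \<open>i div t\<close> translated by \<open>i mod t\<close>;
  adding \<open>i\<close> itself has the same effect modulo \<open>t\<close>. In a fixed column each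
  block of \<open>t\<close> subjects meets every treatment once.\<close>

lemma vatican_cyclic:
  fixes r :: "nat \<Rightarrow> nat \<Rightarrow> nat"
  assumes t: "t > 0"
    and less: "\<And>a j. a < l \<Longrightarrow> j < t \<Longrightarrow> r a j < t"
    and inj: "\<And>a. a < l \<Longrightarrow> inj_on (r a) {..<t}"
    and diff: "\<And>d z. 0 < d \<Longrightarrow> d < t \<Longrightarrow> 0 < z \<Longrightarrow> z < t \<Longrightarrow>
      card {(a, j). a < l \<and> j + d < t \<and> (r a j + z) mod t = r a (j + d)} \<le> l"
  shows "vatican_design (l * t) t (\<lambda>i j. (r (i div t) j + i) mod t)"
proof -
  define D where "D = (\<lambda>i j. (r (i div t) j + i) mod t)"
  have div: "i div t < l" if "i < l * t" for i
    using that by (simp add: less_mult_imp_div_less)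
  have i_eq: "i = i'" if "i div t = i' div t" "D i j = D i' j" for i i' j
  proof -
    have "(r (i div t) j + i mod t) mod t = (r (i div t) j + i' mod t) mod t"
      using that by (simp add: D_def mod_add_right_eq)
    then have "i mod t = i' mod t"
      by (rule cong_add_lcancel_less) (use t in auto)
    then show ?thesis
      using that(1) by (metis div_mult_mod_eq)
  qed
  have column: "card {i. i < l * t \<and> D i j = x} = l" if "j < t" "x < t" for j x
  proof -
    have "bij_betw (\<lambda>i. i div t) {i. i < l * t \<and> D i j = x} {..<l}"
    proof (rule bij_betwI')
      fix i i' assume "i \<in> {i. i < l * t \<and> D i j = x}" "i' \<in> {i. i < l * t \<and> D i j = x}"
      then show "i div t = i' div t \<longleftrightarrow> i = i'"
        using i_eq[of i i' j] by auto
    next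
      fix i assume "i \<in> {i. i < l * t \<and> D i j = x}"
      then show "i div t \<in> {..<l}"
        using div by auto
    next
      fix a assume "a \<in> {..<l}"
      then have a: "a < l" by simp
      \<comment> \<open>The translate of base row \<open>a\<close> that moves its entry in period
        \<open>j\<close> to \<open>x\<close>; the summand \<open>t\<close> keeps the difference
        nonnegative.\<close>
      define i where "i = a * t + (x + t - r a j) mod t"
      have "i div t = a"
        using t by (simp add: i_def)
      moreover have "i < l * t"
        using a t calculation by (metis div_less_iff_less_mult)
      moreover have "(r a j + (x + t - r a j)) mod t = x"
        using less[OF a that(1)] that(2) by simp
      then have "(r a j + i) mod t = x"
        unfolding i_def by (metis add.left_commute mod_add_right_eq mod_mult_self3)
      ultimately show "\<exists>i\<in>{i. i < l * t \<and> D i j = x}. a = i div t"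
        by (auto simp: D_def)
    qed
    then show ?thesis
      by (simp add: bij_betw_same_card)
  qed
  have rows: "inj_on (D i) {..<t}" if "i < l * t" for i
  proof (rule inj_onI)
    fix j j' assume j: "j \<in> {..<t}" "j' \<in> {..<t}" and "D i j = D i j'"
    then have "(i + r (i div t) j) mod t = (i + r (i div t) j') mod t"
      by (simp add: D_def add.commute)
    then have "r (i div t) j = r (i div t) j'"
      by (rule cong_add_lcancel_less) (use less div that j in auto)
    then show "j = j'"
      using inj[OF div[OF that]] j by (auto dest: inj_onD)
  qed
  have occ: "occ (l * t) t D d x y \<le> l"
    if d: "0 < d" "d < t" and xy: "x < t" "y < t" "x \<noteq> y" for d x y
  proof -
    \<comment> \<open>The difference y - x modulo \<open>t\<close> is unchanged by translation. The
      treatment \<open>x\<close> fixes the translate, so an occurrence of (x, y) is determined by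
      its base row and period.\<close>
    define z where "z = (y + t - x) mod t"
    have z_add: "(x + z) mod t = y"
      using xy by (simp add: z_def mod_add_right_eq)
    then have z: "0 < z" "z < t"
      using xy t by (auto simp: z_def intro!: gr0I)
    let ?S = "{(i, j). i < l * t \<and> j + d < t \<and> D i j = x \<and> D i (j + d) = y}"
    let ?T = "{(a, j). a < l \<and> j + d < t \<and> (r a j + z) mod t = r a (j + d)}"
    have "finite ?T"
      by (rule finite_subset[of _ "{..<l} \<times> {..<t}"]) auto
    moreover have "inj_on (\<lambda>(i, j). (i div t, j)) ?S"
      by (rule inj_onI, clarsimp) (metis i_eq)
    moreover have "(\<lambda>(i, j). (i div t, j)) ` ?S \<subseteq> ?T"
    proof clarsimp
      fix i j assume h: "i < l * t" "j + d < t" "x = D i j" "y = D i (j + d)"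
      let ?r = "r (i div t)"
      have "(i + ?r (j + d)) mod t = (x + z) mod t"
        using z_add h by (simp add: D_def add.commute)
      also have "\<dots> = (i + (?r j + z) mod t) mod t"
        using h(3) by (simp add: D_def mod_simps ac_simps)
      finally have "?r (j + d) = (?r j + z) mod t"
        by (rule cong_add_lcancel_less) (use less div h t in auto)
      then show "i div t < l \<and> (?r j + z) mod t = ?r (j + d)"
        using div h by simp
    qed
    ultimately have "card ?S \<le> card ?T"
      by (intro card_inj_on_le)
    then show ?thesis
      using diff[OF d z] by (simp add: occ_def)
  qed
  have "uniform_design (l * t) t D"
    using t column rows by (intro uniform_designI) (auto simp: D_def)
  with occ t have "vatican_design (l * t) t D"
    by (intro vatican_designI) auto
  then show ?thesis
    by (simp add: D_def)
qed

text \<open>At distance d all differences in row \<open>a\<close> equal (a + 1) d, and d is a unit,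
  so \<open>z\<close> fixes \<open>a\<close>. What remains is the choice of j < t - d, at most t - 1
  values.\<close>

lemma vatican_linear_rows:
  assumes "prime t"
  shows "\<exists>D. vatican_design ((t - 1) * t) t D"
proof -
  define r where "r a j = (a + 1) * j mod t" for a j
  have t: "t > 0"
    using assms prime_gt_0_nat by blast
  have cop: "coprime k t" if "0 < k" "k < t" for k
    using that assms by (intro coprime_less_prime)
  have "inj_on (r a) {..<t}" if "a < t - 1" for a
  proof (rule inj_onI)
    fix j j' assume "j \<in> {..<t}" "j' \<in> {..<t}" "r a j = r a j'"
    then show "j = j'"
      using cong_mult_lcancel_nat[OF cop[of "a + 1"], of j j'] that by (auto simp: cong_def r_def)
  qed
  moreover have "card {(a, j). a < t - 1 \<and> j + d < t \<and> (r a j + z) mod t = r a (j + d)} \<le> t - 1"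
    (is "card ?S \<le> _") if d: "0 < d" "d < t" for d z
  proof -
    have "inj_on snd ?S"
    proof (rule inj_onI, clarsimp)
      fix a b j
      assume h: "a < t - Suc 0" "b < t - Suc 0"
        "(r a j + z) mod t = r a (j + d)" "(r b j + z) mod t = r b (j + d)"
      have *: "[z = (c + 1) * d] (mod t)" if "(r c j + z) mod t = r c (j + d)" for c
      proof -
        have "[(c + 1) * j + z = (c + 1) * j + (c + 1) * d] (mod t)"
          using that by (simp add: r_def cong_def mod_simps algebra_simps)
        then show ?thesis
          using cong_add_lcancel_nat by blast
      qed
      have "[(a + 1) * d = (b + 1) * d] (mod t)"
        using *[OF h(3)] *[OF h(4)] cong_trans cong_sym by blast
      then have "[a + 1 = b + 1] (mod t)"
        using cong_mult_rcancel_nat[OF cop[OF d]] by blast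
      then show "a = b"
        using h by (simp add: cong_def)
    qed
    moreover have "snd ` ?S \<subseteq> {..<t - 1}"
      using d by auto
    ultimately have "card ?S \<le> card {..<t - 1}"
      by (intro card_inj_on_le) auto
    then show ?thesis
      by simp
  qed
  ultimately show ?thesis
    using t vatican_cyclic[of t "t - 1" r] by (auto simp: r_def)
qed

subsection \<open>Explicit base rows\<close>

text \<open>For entries below \<open>t\<close> the summand \<open>t\<close> prevents truncated
  subtraction, and \<open>map2\<close> stops with the shorter list \<open>drop d r\<close>, so only
  pairs of positions inside the row enter.\<close>

definition diffs :: "nat \<Rightarrow> nat \<Rightarrow> nat list \<Rightarrow> nat list" where
  "diffs t d r = map2 (\<lambda>u v. (v + t - u) mod t) r (drop d r)"

text \<open>
  Phrased with list operations only, so that concrete instances can be decided by \<open>code_simp\<close>.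
\<close>

definition vatican_base :: "nat \<Rightarrow> nat list list \<Rightarrow> bool" where
  "vatican_base t rs \<longleftrightarrow>
     (\<forall>r\<in>set rs. length r = t \<and> distinct r \<and> (\<forall>v\<in>set r. v < t)) \<and>
     (\<forall>d\<in>set [1..<t]. let xs = concat (map (diffs t d) rs)
        in \<forall>z\<in>set [1..<t]. count_list xs z \<le> length rs)"

lemma count_list_concat: "count_list (concat xss) z = (\<Sum>xs\<leftarrow>xss. count_list xs z)"
  by (induction xss) auto

text \<open>Links the executable count to the sets in \<open>vatican_cyclic\<close>: on residues, v
  - u = z and u + z = v are equivalent.\<close>

lemma count_list_diffs:
  assumes "length r = t" "\<forall>v\<in>set r. v < t" "z < t"
  shows "count_list (diffs t d r) z = card {j. j + d < t \<and> (r ! j + z) mod t = r ! (j + d)}"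
proof -
  have "(v + t - u) mod t = z \<longleftrightarrow> (u + z) mod t = v" if "u < t" "v < t" for u v
  proof
    assume "(v + t - u) mod t = z"
    then have "(u + z) mod t = (u + (v + t - u)) mod t"
      by (metis mod_add_right_eq)
    then show "(u + z) mod t = v"
      using that by simp
  next
    assume "(u + z) mod t = v"
    then have "(u + (v + t - u) mod t) mod t = (u + z) mod t"
      using that by (simp add: mod_add_right_eq)
    then show "(v + t - u) mod t = z"
      by (rule cong_add_lcancel_less) (use assms that in auto)
  qed
  then have "(r ! (j + d) + t - r ! j) mod t = z \<longleftrightarrow> (r ! j + z) mod t = r ! (j + d)"
    if "j + d < t" for j
    using assms that by simp
  then have "{j. j + d < t \<and> (r ! (j + d) + t - r ! j) mod t = z}
      = {j. j + d < t \<and> (r ! j + z) mod t = r ! (j + d)}"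
    by blast
  then show ?thesis
    using assms(1)
    by (simp add: diffs_def count_list_eq_length_filter length_filter_conv_card add.commute[of d]
        less_diff_conv eq_commute[of z] cong: conj_cong)
qed

lemma vatican_of_base:
  assumes "vatican_base t rs" "length rs = l" "t > 0"
  shows "\<exists>D. vatican_design (l * t) t D"
proof -
  have len: "length (rs ! a) = t" and dist: "distinct (rs ! a)" and less: "\<forall>v\<in>set (rs ! a). v < t"
    if "a < l" for a
    using assms(1,2) that by (auto simp: vatican_base_def)
  have "card {(a, j). a < l \<and> j + d < t \<and> (rs ! a ! j + z) mod t = rs ! a ! (j + d)}
      \<le> l" (is "card ?S \<le> _") if "0 < d" "d < t" "0 < z" "z < t" for d z
  proof -
    \<comment> \<open>Splitting by base row matches the concatenation in
      \<open>vatican_base\<close>.\<close>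
    have "?S = (SIGMA a:{..<l}. {j. j + d < t \<and> (rs ! a ! j + z) mod t = rs ! a ! (j + d)})"
      by auto
    then have "card ?S = (\<Sum>a<l. card {j. j + d < t \<and> (rs ! a ! j + z) mod t = rs ! a ! (j + d)})"
      by (simp add: finite_subset[OF _ finite_lessThan[of t]] subset_iff)
    also have "\<dots> = (\<Sum>a<l. count_list (diffs t d (rs ! a)) z)"
      using len less that(4) by (intro sum.cong) (auto simp: count_list_diffs)
    also have "\<dots> = count_list (concat (map (diffs t d) rs)) z"
      using assms(2) by (simp add: count_list_concat sum_list_sum_nth comp_def atLeast0LessThan)
    also have "\<dots> \<le> l"
      using assms(1,2) that by (auto simp: vatican_base_def Let_def)
    finally show ?thesis .
  qed
  moreover have "inj_on ((!) (rs ! a)) {..<t}" if "a < l" for a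
    using that len dist by (auto simp: inj_on_def distinct_conv_nth)
  ultimately show ?thesis
    using assms(3) len less
    by (intro exI[of _ "\<lambda>i j. (rs ! (i div t) ! j + i) mod t"] vatican_cyclic) auto
qed

definition multiples :: "nat \<Rightarrow> nat list \<Rightarrow> nat list \<Rightarrow> nat list list" where
  "multiples t us r = map (\<lambda>u. map (\<lambda>v. u * v mod t) r) us"

text \<open>
  The rows below were found by a backtracking search. If the base rows are the multiples of one row
  by a group of units modulo \<open>t\<close>, only the number of differences in each orbit of that group
  matters, which makes the search short. For \<open>l = 2\<close> the group \<open>{1, -1}\<close> works throughout; for
  \<open>l = 3\<close> a group of order 3 is used for \<open>t = 7, 13, 14\<close>, while 5, 8 and 11 admit none and that of
  9 gives no solution.
\<close>

lemma vatican_2: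
  assumes "t \<in> {3, 5, 7, 8, 9, 11, 13, 14, 15}"
  shows "\<exists>D. vatican_design (2 * t) t D"
proof -
  \<comment> \<open>Translating a row keeps its differences, so each can be taken to start with
    0.\<close>
  have "vatican_base 3 (multiples 3 [1,2] [0,1,2])"
    "vatican_base 5 (multiples 5 [1,4] [0,1,3,2,4])"
    "vatican_base 7 (multiples 7 [1,6] [0,2,6,5,1,3,4])"
    "vatican_base 8 (multiples 8 [1,7] [0,2,7,3,1,6,5,4])"
    "vatican_base 9 (multiples 9 [1,8] [0,4,2,8,3,5,6,7,1])"
    "vatican_base 11 (multiples 11 [1,10] [0,8,2,1,7,9,5,4,6,3,10])"
    "vatican_base 13 (multiples 13 [1,12] [0,8,11,6,7,9,2,3,12,10,4,1,5])"
    "vatican_base 14 (multiples 14 [1,13] [0,7,2,8,5,4,3,13,11,6,10,12,1,9])"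
    "vatican_base 15 (multiples 15 [1,14] [0,4,1,10,2,8,13,3,6,7,14,12,11,9,5])"
    by code_simp+
  note this[THEN vatican_of_base[where l = 2]]
  then show ?thesis
    using assms by (auto simp: multiples_def)
qed

lemma vatican_3:
  assumes "t \<in> {5, 7, 8, 9, 11, 13, 14}"
  shows "\<exists>D. vatican_design (3 * t) t D"
proof -
  have "vatican_base 5 [[0,3,1,2,4], [0,4,3,1,2], [0,1,3,2,4]]"
    "vatican_base 7 (multiples 7 [1,2,4] [0,4,2,6,5,1,3])"
    "vatican_base 8 [[0,6,7,2,4,3,1,5], [0,5,6,3,7,2,1,4], [0,4,6,7,5,2,1,3]]"
    "vatican_base 9 [[0,7,1,3,6,5,4,8,2], [0,1,8,7,4,2,3,5,6], [0,5,7,2,6,3,8,4,1]]"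
    "vatican_base 11 [[0,3,4,2,7,1,5,8,6,9,10], [0,5,9,8,4,10,6,7,2,1,3], [0,10,7,2,4,8,6,3,5,1,9]]"
    "vatican_base 13 (multiples 13 [1,3,9] [0,4,12,10,11,5,7,6,2,3,9,8,1])"
    "vatican_base 14 (multiples 14 [1,9,11] [0,4,1,5,7,10,3,13,12,11,6,2,8,9])"
    by code_simp+
  note this[THEN vatican_of_base[where l = 3]]
  then show ?thesis
    using assms by (auto simp: multiples_def)
qed

section \<open>Assembling the four cases\<close>

theorem theorem1:
  fixes t l :: nat
  assumes "t \<ge> 2" and "l \<ge> 1"
    and "prime (t + 1) \<or>
         (5 \<le> t \<and> t \<le> 14 \<and> l > 1) \<or>
         (t \<in> {3, 15} \<and> even l) \<or>
         (prime t \<and> (t - 1) dvd l)"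
  shows "\<exists>D. vatican_design (l * t) t D"
proof -
  have mult_table: "\<exists>D. vatican_design (l * t) t D" if "prime (t + 1)"
    using vatican_multiple[of 1 t _ l] vatican_mult_table[OF that] by auto
  from assms(3) show ?thesis
  proof (elim disjE conjE)
    assume "prime (t + 1)"
    then show ?thesis
      by (rule mult_table)
  next
    assume t: "5 \<le> t" "t \<le> 14" and l: "l > 1"
    \<comment> \<open>For 6, 10 and 12 the successor is prime and the multiplication table applies;
      base rows are listed for the other values.\<close>
    show ?thesis
    proof (cases "t \<in> {6, 10, 12}")
      case True
      moreover have "prime (7::nat)" "prime (11::nat)" "prime (13::nat)"
        by simp_all
      ultimately show ?thesis
        by (intro mult_table) auto
    next
      case False
      then have "t \<in> {5, 7, 8, 9, 11, 13, 14}"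
        using t by simp presburger
      then obtain D E where "vatican_design (2 * t) t D" "vatican_design (3 * t) t E"
        using vatican_2[of t] vatican_3[of t] by blast
      then show ?thesis
        using vatican_2_3 l by blast
    qed
  next
    assume t: "t \<in> {3, 15}" and "even l"
    then obtain k where l: "l = k * 2"
      by (metis dvdE mult.commute)
    obtain D where "vatican_design (2 * t) t D"
      using vatican_2[of t] t by blast
    then show ?thesis
      unfolding l by (rule vatican_multiple)
  next
    assume "prime t" "(t - 1) dvd l"
    then obtain k where l: "l = k * (t - 1)"
      by (metis dvdE mult.commute)
    obtain D where "vatican_design ((t - 1) * t) t D"
      using vatican_linear_rows \<open>prime t\<close> by blast
    then show ?thesis
      unfolding l by (rule vatican_multiple)
  qed
qed

end
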